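(* Fix $k\in\{1,\dots,n\}$, prices $r_1,\dots,r_n\ge 0$ and intrinsic valuations $v_1,\dots,v_n\in\mathbb R$. For $S\subseteq\mathcal N=\{1,\dots,n\}$ write $\mathrm{Rev}(\mathrm{Opq}^*_{(k)}(S,\bm r_S))=\max_{\rho\ge 0}\mathrm{Rev}(\mathrm{Opq}_{(k)}(S,\bm r_S,\rho))$. Let $\mathcal S=\{S_{r(i)}\cap S_{v(j)}: i,j\in\{1,\dots,n\}\}$ be the set of candidate assortments of the nested-by-revenue-and-valuation (NRV) heuristic, and let $S^*$ denote an optimal assortment, i.e. a maximizer of $\mathrm{Rev}(\mathrm{Opq}^*_{(k)}(S,\bm r_S))$ over $S\subseteq\mathcal N$. (a) If $n=2$, NRV is optimal: some optimal assortment $S^*$ belongs to $\arg\max_{S\in\mathcal S}\mathrm{Rev}(\mathrm{Opq}^*_{(k)}(S,\bm r_S))$. (b) If $n\ge 3$, NRV has a $1/2$ approximation ratio: $$\max_{S\in\mathcal S}\mathrm{Rev}\big(\mathrm{Opq}^*_{(k)}(S,\bm r_S)\big)\ \ge\ \tfrac12\,\mathrm{Rev}\big(\mathrm{Opq}^*_{(k)}(S^*,\bm r_{S^*})\big).$$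
   Context: Setting. Customer valuations are $V_i=v_i+\epsilon_i$ for $i\in\mathcal N=\{1,\dots,n\}$ and $V_0=\epsilon_0$ for the no-purchase option $0$, with $\epsilon_0,\dots,\epsilon_n$ i.i.d. standard Gumbel$(0,1)$. For $S\subseteq\mathcal N$, $\bm r_S=(r_i)_{i\in S}$; utilities are $U_i=V_i-r_i$ and $U_0=V_0$. Opaque-MNL model with full support, $\mathrm{Opq}_{(k)}(S,\bm r_S,\rho)$: the products of $S$ are offered at prices $\bm r_S$ together with an opaque product $q$ at price $\rho$. The customer's valuation of $q$ is $V_{(k)}^S$, the $k$-th smallest value among $\{V_j:j\in S\}$, with the convention $V_{(k)}^S=\max_{j\in S}V_j$ if $k>|S|$ (if $S=\emptyset$ then nothing is sold and the revenue is $0$). The utility of $q$ is $U_q=V_{(k)}^S-\rho$. The customer chooses the option of highest utility in $S\cup\{0,q\}$, ties between $q$ and another option being broken in favor of $q$. With $\pi(\cdot)$ the resulting choice probabilities, $\mathrm{Rev}(\mathrm{Opq}_{(k)}(S,\bm r_S,\rho))=\sum_{i\in S}r_i\,\pi(i)+\rho\,\pi(q)$. NRV candidates: $S_{r(i)}$ is the set of the first $i$ products when $\mathcal N$ is sorted in decreasing order of price $r$, and $S_{v(j)}$ is the set of the first $j$ products when $\mathcal N$ is sorted in decreasing order of intrinsic valuation $v$; ties in both rankings are broken by the original index (smaller index first). *)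

theory Defs
  imports "HOL-Probability.Probability"
begin

text \<open>Derivative of the cumulative distribution function \<open>exp (- exp (- x))\<close>.\<close>

definition std_gumbel_density :: "real \<Rightarrow> real" where
  "std_gumbel_density x = exp (- x) * exp (- exp (- x))"

text \<open>Option 0 is the no-purchase option, so the value \<open>v 0\<close> (and likewise the price \<open>r 0\<close> below)
  is never used.  The argument \<open>e\<close> is a realization of the noise vector.\<close>

definition valuation :: "(nat \<Rightarrow> real) \<Rightarrow> (nat \<Rightarrow> real) \<Rightarrow> nat \<Rightarrow> real" where
  "valuation v e i = (if i = 0 then e 0 else v i + e i)"

definition utility :: "(nat \<Rightarrow> real) \<Rightarrow> (nat \<Rightarrow> real) \<Rightarrow> (nat \<Rightarrow> real) \<Rightarrow> nat \<Rightarrow> real" where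
  "utility v r e i = (if i = 0 then valuation v e 0 else valuation v e i - r i)"

text \<open>The \<open>k\<close>-th smallest valuation in \<open>S\<close> (counted from 1, with multiplicity), or the largest one
  if \<open>k > card S\<close>.  Only meaningful for finite nonempty \<open>S\<close> and \<open>k \<ge> 1\<close>.\<close>

definition opaque_valuation ::
    "(nat \<Rightarrow> real) \<Rightarrow> nat \<Rightarrow> nat set \<Rightarrow> (nat \<Rightarrow> real) \<Rightarrow> real" where
  "opaque_valuation v k S e =
     (if k \<le> card S then sort (map (valuation v e) (sorted_list_of_set S)) ! (k - 1)
      else Max (valuation v e ` S))"

definition opaque_utility ::
    "(nat \<Rightarrow> real) \<Rightarrow> nat \<Rightarrow> nat set \<Rightarrow> real \<Rightarrow> (nat \<Rightarrow> real) \<Rightarrow> real" where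
  "opaque_utility v k S \<rho> e = opaque_valuation v k S e - \<rho>"

text \<open>Choice probabilities.  A tie between the opaque product and another option may have positive
  probability (e.g. if \<open>\<rho> = r j\<close>) and is resolved in favor of the opaque product.  A tie between
  two options of \<open>insert 0 S\<close> is a null event for independent Gumbel noise, so its
  resolution is immaterial.\<close>

definition opaque_choice_prob ::
    "'a measure \<Rightarrow> (nat \<Rightarrow> 'a \<Rightarrow> real) \<Rightarrow> (nat \<Rightarrow> real) \<Rightarrow> nat \<Rightarrow> nat set \<Rightarrow> (nat \<Rightarrow> real)
      \<Rightarrow> real \<Rightarrow> real" where
  "opaque_choice_prob M eps v k S r \<rho> =
     measure M {\<omega> \<in> space M. \<forall>j \<in> insert 0 S.
        utility v r (\<lambda>l. eps l \<omega>) j \<le> opaque_utility v k S \<rho> (\<lambda>l. eps l \<omega>)}"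

definition choice_prob ::
    "'a measure \<Rightarrow> (nat \<Rightarrow> 'a \<Rightarrow> real) \<Rightarrow> (nat \<Rightarrow> real) \<Rightarrow> nat \<Rightarrow> nat set \<Rightarrow> (nat \<Rightarrow> real)
      \<Rightarrow> real \<Rightarrow> nat \<Rightarrow> real" where
  "choice_prob M eps v k S r \<rho> i =
     measure M {\<omega> \<in> space M.
        opaque_utility v k S \<rho> (\<lambda>l. eps l \<omega>) < utility v r (\<lambda>l. eps l \<omega>) i \<and>
        (\<forall>j \<in> insert 0 S - {i}.
           utility v r (\<lambda>l. eps l \<omega>) j < utility v r (\<lambda>l. eps l \<omega>) i)}"

definition opq_rev ::
    "'a measure \<Rightarrow> (nat \<Rightarrow> 'a \<Rightarrow> real) \<Rightarrow> (nat \<Rightarrow> real) \<Rightarrow> nat \<Rightarrow> (nat \<Rightarrow> real) \<Rightarrow> nat set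
      \<Rightarrow> real \<Rightarrow> real" where
  "opq_rev M eps v k r S \<rho> =
     (if S = {} then 0
      else (\<Sum>i\<in>S. r i * choice_prob M eps v k S r \<rho> i)
           + \<rho> * opaque_choice_prob M eps v k S r \<rho>)"

text \<open>Maximal revenue over the opaque price.  The supremum is a maximum: the revenue is continuous in
  \<open>\<rho>\<close>, and above the largest price in \<open>S\<close> the opaque product is never bought, so that the
  revenue no longer depends on \<open>\<rho>\<close>.\<close>

definition opq_rev_opt ::
    "'a measure \<Rightarrow> (nat \<Rightarrow> 'a \<Rightarrow> real) \<Rightarrow> (nat \<Rightarrow> real) \<Rightarrow> nat \<Rightarrow> (nat \<Rightarrow> real) \<Rightarrow> nat set
      \<Rightarrow> real" where
  "opq_rev_opt M eps v k r S = (SUP \<rho>\<in>{0..}. opq_rev M eps v k r S \<rho>)"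

text \<open>The sort is stable, so among products with equal \<open>f\<close> the smaller index comes first.\<close>

definition top_ranked :: "nat \<Rightarrow> (nat \<Rightarrow> real) \<Rightarrow> nat \<Rightarrow> nat set" where
  "top_ranked n f i = set (take i (sort_key (\<lambda>l. - f l) [1..<Suc n]))"

definition nrv_candidates ::
    "nat \<Rightarrow> (nat \<Rightarrow> real) \<Rightarrow> (nat \<Rightarrow> real) \<Rightarrow> nat set set" where
  "nrv_candidates n r v =
     {top_ranked n r i \<inter> top_ranked n v j | i j. i \<in> {1..n} \<and> j \<in> {1..n}}"

end

(* Let \<rho> be the opaque price and S an assortment. The traditional sales from S earn at most the
   MNL revenue of S, which is bounded by that of a revenue-ordered assortment, a candidate whose
   opaque product may be priced out of the market. If the opaque product is bought, then all
   products of S worth at least as much to the customer as the opaque one cost at least \<rho>.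
   So the opaque sales only involve the part T of S priced at least \<rho>. Replacing T by the
   card T most valued products among all those priced at least \<rho> gives a candidate; by
   exchangeability of the noise its k-th smallest valuation dominates that of T, and each of its
   purchases earns at least \<rho>. Hence each of the two parts of the revenue is at most the best
   candidate's revenue. For two products, the only assortments that may fail to be candidates are
   the empty one and a single product dominated in both price and valuation. *)

theory Submission
  imports Defs
begin

section \<open>Order statistics and the opaque valuation\<close>

text \<open>Entries at least \<open>c\<close> form a suffix of the sorted list; it reaches back to
  index \<open>m\<close> exactly when it has at least \<open>length xs - m\<close> entries. Their
  number does not depend on the order of the list.\<close>

lemma sort_nth_ge_iff:
  fixes xs :: "'a::linorder list"
  assumes "m < length xs"
  shows "c \<le> sort xs ! m \<longleftrightarrow> length xs - m \<le> length (filter (\<lambda>x. c \<le> x) xs)"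
proof -
  define ys where "ys = sort xs"
  have ys: "sorted ys" "length ys = length xs" "mset ys = mset xs"
    by (simp_all add: ys_def)
  have len: "length (filter (\<lambda>x. c \<le> x) xs) = card {i. i < length ys \<and> c \<le> ys ! i}"
    using ys(3) by (metis length_filter_conv_card mset_filter size_mset)
  have "c \<le> ys ! m \<longleftrightarrow> length ys - m \<le> card {i. i < length ys \<and> c \<le> ys ! i}"
  proof
    assume "c \<le> ys ! m"
    then have "{m..<length ys} \<subseteq> {i. i < length ys \<and> c \<le> ys ! i}"
      using ys(1) by (auto dest: sorted_nth_mono order_trans)
    from card_mono[OF _ this] show "length ys - m \<le> card {i. i < length ys \<and> c \<le> ys ! i}"
      by simp
  next
    assume A: "length ys - m \<le> card {i. i < length ys \<and> c \<le> ys ! i}"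
    show "c \<le> ys ! m"
    proof (rule ccontr)
      assume "\<not> c \<le> ys ! m"
      then have "{i. i < length ys \<and> c \<le> ys ! i} \<subseteq> {Suc m..<length ys}"
        using ys assms by (auto simp: not_le Suc_le_eq)
          (metis leD le_less_trans not_le_imp_less sorted_nth_mono)
      from card_mono[OF _ this] A assms ys(2) show False by simp
    qed
  qed
  then show ?thesis using len ys(2) by (simp add: ys_def)
qed

text \<open>Counting avoids order statistics altogether, and it treats the two branches of the
  convention for \<open>k > card S\<close> uniformly.\<close>

lemma le_opaque_valuation_iff:
  assumes "finite S" "S \<noteq> {}" "1 \<le> k"
  shows "c \<le> opaque_valuation v k S e \<longleftrightarrow>
    max 1 (Suc (card S) - k) \<le> card {i \<in> S. c \<le> valuation v e i}"
proof (cases "k \<le> card S")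
  case True
  define xs where "xs = sorted_list_of_set S"
  have xs: "length xs = card S" "distinct xs" "set xs = S"
    using assms by (simp_all add: xs_def)
  have "length (filter (\<lambda>x. c \<le> x) (map (valuation v e) xs))
      = length (filter (\<lambda>i. c \<le> valuation v e i) xs)"
    by (simp add: filter_map comp_def)
  also have "\<dots> = card {i \<in> S. c \<le> valuation v e i}"
    using xs by (metis distinct_card distinct_filter set_filter)
  finally have *: "length (filter (\<lambda>x. c \<le> x) (map (valuation v e) xs)) = \<dots>" .
  have "c \<le> opaque_valuation v k S e \<longleftrightarrow> c \<le> sort (map (valuation v e) xs) ! (k - 1)"
    using True by (simp add: opaque_valuation_def xs_def)
  also have "\<dots> \<longleftrightarrow> card S - (k - 1) \<le> card {i \<in> S. c \<le> valuation v e i}"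
    using sort_nth_ge_iff[of "k - 1" "map (valuation v e) xs" c] * xs True assms by simp
  also have "card S - (k - 1) = max 1 (Suc (card S) - k)"
    using True assms by simp
  finally show ?thesis .
next
  case False
  then have "c \<le> opaque_valuation v k S e \<longleftrightarrow> (\<exists>i\<in>S. c \<le> valuation v e i)"
    using assms by (simp add: opaque_valuation_def Max_ge_iff)
  also have "\<dots> \<longleftrightarrow> {i \<in> S. c \<le> valuation v e i} \<noteq> {}" by auto
  also have "\<dots> \<longleftrightarrow> 1 \<le> card {i \<in> S. c \<le> valuation v e i}"
    using assms by (simp add: Suc_le_eq card_gt_0_iff)
  \<comment> \<open>For \<open>k > card S\<close> the truncated difference
    \<open>Suc (card S) - k\<close> is 0, and \<open>max 1\<close> encodes the convention that the
    opaque valuation is then the maximum.\<close>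
  finally show ?thesis using False by (simp add: max_def)
qed

text \<open>Counting with \<open>c\<close> equal to the opaque valuation itself: the threshold is at
  least 1, so some product reaches it.\<close>

lemma opaque_valuation_le_Max:
  assumes "finite S" "S \<noteq> {}" "1 \<le> k"
  shows "\<exists>i\<in>S. opaque_valuation v k S e \<le> valuation v e i"
proof -
  have "1 \<le> card {i \<in> S. opaque_valuation v k S e \<le> valuation v e i}"
    using le_opaque_valuation_iff[OF assms, of "opaque_valuation v k S e" v e] by simp
  then have "{i \<in> S. opaque_valuation v k S e \<le> valuation v e i} \<noteq> {}"
    by (metis card.empty not_one_le_zero)
  then show ?thesis by auto
qed

lemma measurable_valuation:
  assumes "\<And>i. i \<in> insert 0 S \<Longrightarrow> X i \<in> borel_measurable N" "i \<in> insert 0 S"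
  shows "(\<lambda>\<omega>. valuation v (\<lambda>l. X l \<omega>) i) \<in> borel_measurable N"
proof -
  have [measurable]: "X i \<in> borel_measurable N" "X 0 \<in> borel_measurable N"
    using assms by auto
  show ?thesis unfolding valuation_def by (cases "i = 0") simp_all
qed

text \<open>By counting, the events to be checked concern a finite sum of indicators. The variables
  \<open>X\<close> are general because both the noise and the coordinates of a product space are
  inserted for them.\<close>

lemma measurable_opaque_valuation:
  assumes "finite S" "S \<noteq> {}" "1 \<le> k"
    and X: "\<And>i. i \<in> insert 0 S \<Longrightarrow> X i \<in> borel_measurable N"
  shows "(\<lambda>\<omega>. opaque_valuation v k S (\<lambda>l. X l \<omega>)) \<in> borel_measurable N"
proof (rule borel_measurableI_ge)
  fix c
  let ?V = "\<lambda>i \<omega>. valuation v (\<lambda>l. X l \<omega>) i"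
  have card_eq: "card {i \<in> S. c \<le> ?V i \<omega>} = (\<Sum>i\<in>S. if c \<le> ?V i \<omega> then 1 else 0)" for \<omega>
    using assms(1) by (simp add: sum.If_cases Int_def)
  have [measurable]: "?V i \<in> borel_measurable N" if "i \<in> S" for i
    using measurable_valuation[of S X N i] X that by simp
  have "{\<omega> \<in> space N. max 1 (Suc (card S) - k)
          \<le> (\<Sum>i\<in>S. if c \<le> ?V i \<omega> then 1 else (0::nat))} \<in> sets N"
    by measurable
  then show "{\<omega> \<in> space N. c \<le> opaque_valuation v k S (\<lambda>l. X l \<omega>)} \<in> sets N"
    by (simp only: le_opaque_valuation_iff[OF assms(1-3)] card_eq)
qed

text \<open>Two reals with the same lower bounds are equal, so counting again suffices. This allows
  a noise vector to be restricted to \<open>insert 0 S\<close>.\<close>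

lemma opaque_valuation_cong:
  assumes "finite S" "S \<noteq> {}" "1 \<le> k" "\<And>i. i \<in> insert 0 S \<Longrightarrow> e i = e' i"
  shows "opaque_valuation v k S e = opaque_valuation v k S e'"
proof -
  have "valuation v e i = valuation v e' i" if "i \<in> S" for i
    using assms(4) that by (simp add: valuation_def)
  then have "{i \<in> S. c \<le> valuation v e i} = {i \<in> S. c \<le> valuation v e' i}" for c
    by auto
  then have "c \<le> opaque_valuation v k S e \<longleftrightarrow> c \<le> opaque_valuation v k S e'" for c
    by (simp add: le_opaque_valuation_iff[OF assms(1-3)])
  then show ?thesis by (meson order_antisym order_refl)
qed

text \<open>Injectivity makes the one-point blocks \<open>{\<sigma> j}\<close> disjoint, and
  restrictions of an independent family to disjoint blocks are independent.\<close>

lemma (in prob_space) indep_vars_reindex_inj: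
  assumes ind: "indep_vars (\<lambda>_. N) X I" and inj: "inj_on \<sigma> J" and sub: "\<sigma> ` J \<subseteq> I"
  shows "indep_vars (\<lambda>_. N) (\<lambda>j. X (\<sigma> j)) J"
proof -
  have "indep_vars (\<lambda>j. PiM {\<sigma> j} (\<lambda>_. N)) (\<lambda>j \<omega>. restrict (\<lambda>i. X i \<omega>) {\<sigma> j}) J"
    using ind inj sub
    by (intro indep_vars_restrict) (auto simp: disjoint_family_on_def inj_on_def)
  then have "indep_vars (\<lambda>_. N) (\<lambda>j \<omega>. (\<lambda>f. f (\<sigma> j)) (restrict (\<lambda>i. X i \<omega>) {\<sigma> j})) J"
    by (rule indep_vars_compose2) simp
  then show ?thesis by simp
qed

section \<open>Revenue under the plain MNL model\<close>

text \<open>The summand 1 in the denominator is the weight \<open>exp 0\<close> of the no-purchase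
  option. \<open>opq_rev_high_price\<close> identifies this closed form with the revenue when the
  opaque product is priced out.\<close>

definition mnl_rev :: "(nat \<Rightarrow> real) \<Rightarrow> (nat \<Rightarrow> real) \<Rightarrow> nat set \<Rightarrow> real" where
  "mnl_rev v r S = (\<Sum>i\<in>S. r i * exp (v i - r i)) / (1 + (\<Sum>i\<in>S. exp (v i - r i)))"

text \<open>The classical argument for revenue-ordered assortments: \<open>mnl_rev v r S \<le> R\<close> says
  \<open>(\<Sum>i\<in>S. (r i - R) * exp (v i - r i)) \<le> R\<close>, whose left-hand side is largest
  for \<open>S = {i \<in> N. R \<le> r i}\<close>.\<close>

lemma mnl_rev_le_if_level_set:
  assumes N: "finite N" "S \<subseteq> N" and R: "mnl_rev v r {i \<in> N. R \<le> r i} \<le> R"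
  shows "mnl_rev v r S \<le> R"
proof -
  have iff: "mnl_rev v r T \<le> R \<longleftrightarrow> (\<Sum>i\<in>T. (r i - R) * exp (v i - r i)) \<le> R" for T
  proof -
    have "0 < 1 + (\<Sum>i\<in>T. exp (v i - r i))"
      by (intro add_pos_nonneg sum_nonneg) auto
    then show ?thesis
      unfolding mnl_rev_def
      by (subst pos_divide_le_eq)
        (auto simp: left_diff_distrib sum_subtractf sum_distrib_left distrib_left)
  qed
  have fin: "finite S" using N finite_subset by blast
  have "(\<Sum>i\<in>S. (r i - R) * exp (v i - r i))
      \<le> (\<Sum>i\<in>{i \<in> S. R \<le> r i}. (r i - R) * exp (v i - r i))"
  proof -
    have "(\<Sum>i\<in>S. (r i - R) * exp (v i - r i))
        \<le> (\<Sum>i\<in>S. if R \<le> r i then (r i - R) * exp (v i - r i) else 0)"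
      by (intro sum_mono) (auto simp: mult_nonpos_nonneg)
    then show ?thesis using fin by (simp add: sum.inter_filter)
  qed
  also have "\<dots> \<le> (\<Sum>i\<in>{i \<in> N. R \<le> r i}. (r i - R) * exp (v i - r i))"
    using N by (intro sum_mono2) auto
  also have "\<dots> \<le> R" using R by (simp add: iff)
  finally show ?thesis by (simp add: iff)
qed

section \<open>Rankings, their prefixes and level sets\<close>

text \<open>A single list \<open>xs\<close> carries all prefixes at once; sorting by
  \<open>- f\<close> puts large values first.\<close>

lemma top_ranked_sort_key:
  obtains xs where "\<And>i. top_ranked n f i = set (take i xs)" "length xs = n" "distinct xs"
    "set xs = {1..n}" "\<And>i j. i \<le> j \<Longrightarrow> j < n \<Longrightarrow> f (xs ! j) \<le> f (xs ! i)"
proof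
  let ?xs = "sort_key (\<lambda>l. - f l) [1..<Suc n]"
  show "top_ranked n f i = set (take i ?xs)" for i by (simp add: top_ranked_def del: upt_Suc)
  show len: "length ?xs = n" "distinct ?xs" "set ?xs = {1..n}"
    by (simp_all del: upt_Suc add: atLeastLessThanSuc_atLeastAtMost)
  show "f (?xs ! j) \<le> f (?xs ! i)" if "i \<le> j" "j < n" for i j
  proof -
    have "sorted (map (\<lambda>l. - f l) ?xs)" by (rule sorted_sort_key)
    from sorted_nth_mono[OF this that(1)] that len show ?thesis by (simp del: upt_Suc)
  qed
qed

lemma top_ranked_subset: "top_ranked n f i \<subseteq> {1..n}"
  by (rule top_ranked_sort_key[of n f]) (auto dest: in_set_takeD)

lemma card_top_ranked: "i \<le> n \<Longrightarrow> card (top_ranked n f i) = i"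
  by (rule top_ranked_sort_key[of n f]) (simp add: distinct_card)

lemma top_ranked_all: "top_ranked n f n = {1..n}"
  by (rule top_ranked_sort_key[of n f]) simp

lemma top_ranked_0: "top_ranked n f 0 = {}"
  by (simp add: top_ranked_def)

lemma card_Int_top_ranked_Suc_le:
  "card (X \<inter> top_ranked n f (Suc j)) \<le> Suc (card (X \<inter> top_ranked n f j))"
proof (rule top_ranked_sort_key[of n f])
  fix xs assume *: "\<And>i. top_ranked n f i = set (take i xs)" "length xs = n"
  show ?thesis
  proof (cases "j < n")
    case True
    then have "X \<inter> top_ranked n f (Suc j) \<subseteq> insert (xs ! j) (X \<inter> top_ranked n f j)"
      using * by (auto simp: take_Suc_conv_app_nth)
    from card_mono[OF _ this] show ?thesis
      using card_insert_le_m1 card_insert_if[of "X \<inter> top_ranked n f j" "xs ! j"]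
      by (auto simp: * split: if_splits)
  qed (use * in simp)
qed

lemma le_top_ranked:
  assumes "a \<in> top_ranked n f i" "b \<in> {1..n} - top_ranked n f i"
  shows "f b \<le> f a"
proof (rule top_ranked_sort_key[of n f])
  fix xs assume *: "\<And>i. top_ranked n f i = set (take i xs)" "length xs = n"
    "set xs = {1..n}" "\<And>i j. i \<le> j \<Longrightarrow> j < n \<Longrightarrow> f (xs ! j) \<le> f (xs ! i)"
  obtain p where p: "p < length (take i xs)" "take i xs ! p = a"
    using assms(1) * by (auto simp: in_set_conv_nth)
  obtain q where q: "q < length xs" "xs ! q = b"
    using assms(2) * by (metis DiffD1 in_set_conv_nth)
  \<comment> \<open>A product outside the prefix of length \<open>i\<close> stands at position
    \<open>i\<close> or later, hence after \<open>a\<close>.\<close>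
  have "i \<le> q"
  proof (rule ccontr)
    assume "\<not> i \<le> q"
    then have "b \<in> set (take i xs)" using q by (auto simp: in_set_conv_nth)
    then show False using assms(2) * by simp
  qed
  then show "f b \<le> f a" using *(4)[of p q] p q *(2) by simp
qed

text \<open>A level set and the prefix of the same size, if distinct, would each contain a product
  missing from the other; the ranking orders their values one way, the threshold strictly the other
  way.\<close>

lemma level_set_eq_top_ranked:
  "{i \<in> {1..n}. t \<le> f i} = top_ranked n f (card {i \<in> {1..n}. t \<le> f i})"
proof -
  define A where "A = {i \<in> {1..n}. t \<le> f i}"
  define B where "B = top_ranked n f (card A)"
  have "card A \<le> card {1..n}" unfolding A_def by (intro card_mono) auto
  then have card: "card B = card A" unfolding B_def by (intro card_top_ranked) simp
  have B: "B \<subseteq> {1..n}" unfolding B_def by (rule top_ranked_subset)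
  have fin: "finite A" "finite B" using B finite_subset by (auto simp: A_def)
  have "A \<subseteq> B"
  proof (rule ccontr)
    assume "\<not> A \<subseteq> B"
    then obtain a where a: "a \<in> A" "a \<notin> B" by blast
    have "\<not> B \<subseteq> A" using a card_subset_eq[OF fin(1) _ card] by blast
    then obtain b where b: "b \<in> B" "b \<notin> A" by blast
    have "f a \<le> f b" using a b(1) by (auto simp: A_def B_def intro!: le_top_ranked)
    then show False using a b B by (auto simp: A_def)
  qed
  then have "A = B" by (rule card_subset_eq[OF fin(2) _ card[symmetric]])
  then show ?thesis by (simp only: A_def B_def)
qed

text \<open>A discrete intermediate value argument: as \<open>j\<close> runs from 0 to
  \<open>n\<close>, the size grows from 0 to \<open>card X\<close> in steps of at most 1.\<close>

lemma ex_top_ranked_Int_card: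
  assumes "X \<subseteq> {1..n}" "m \<le> card X"
  shows "\<exists>j\<le>n. card (X \<inter> top_ranked n f j) = m"
proof -
  define g where "g j = card (X \<inter> top_ranked n f j)" for j
  have g: "g 0 = 0" "\<And>j. g (Suc j) \<le> Suc (g j)" "g n = card X"
    using assms card_Int_top_ranked_Suc_le
    by (simp_all add: g_def top_ranked_0 top_ranked_all Int_absorb2)
  have "m \<le> g n" using g assms by simp
  then have "\<exists>j\<le>n. g j = m"
  proof (induction n)
    case 0
    then show ?case using g(1) by auto
  next
    case (Suc n)
    show ?case
    proof (cases "m \<le> g n")
      case True
      then show ?thesis using Suc.IH by (meson le_SucI)
    next
      case False
      then have "g (Suc n) = m" using Suc.prems g(2)[of n] by simp
      then show ?thesis by blast
    qed
  qed
  then show ?thesis by (simp add: g_def)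
qed

text \<open>\<open>\<sigma>\<close> fixes the common elements and sends \<open>T - U\<close> to the
  equally large \<open>U - T\<close> in any way, since every element of \<open>U\<close> has value
  at least that of every element of \<open>X - U\<close>.\<close>

lemma ex_bij_betw_top:
  fixes v :: "'a \<Rightarrow> 'b::preorder"
  assumes "finite X" "T \<subseteq> X" "U \<subseteq> X" "card T = card U"
    and top: "\<And>a b. a \<in> U \<Longrightarrow> b \<in> X - U \<Longrightarrow> v b \<le> v a"
  shows "\<exists>\<sigma>. bij_betw \<sigma> T U \<and> (\<forall>i\<in>T. v i \<le> v (\<sigma> i))"
proof -
  have fin: "finite T" "finite U" using assms finite_subset by blast+
  have "card (T - U) = card (U - T)"
    using fin assms(4) card_Diff_subset_Int[of T U] card_Diff_subset_Int[of U T]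
    by (simp add: Int_commute)
  then obtain h where h: "bij_betw h (T - U) (U - T)"
    using fin finite_same_card_bij[of "T - U" "U - T"] by auto
  define \<sigma> where "\<sigma> i = (if i \<in> U then i else h i)" for i
  have "bij_betw \<sigma> (T \<inter> U) (T \<inter> U)"
    by (auto simp: \<sigma>_def bij_betw_def inj_on_def)
  moreover have "bij_betw \<sigma> (T - U) (U - T)"
    using h by (subst bij_betw_cong[of _ _ h]) (auto simp: \<sigma>_def)
  ultimately have "bij_betw \<sigma> ((T \<inter> U) \<union> (T - U)) ((T \<inter> U) \<union> (U - T))"
    by (rule bij_betw_combine) auto
  moreover have "(T \<inter> U) \<union> (T - U) = T" "(T \<inter> U) \<union> (U - T) = U" by auto
  ultimately have "bij_betw \<sigma> T U" by simp
  moreover have "v i \<le> v (\<sigma> i)" if "i \<in> T" for i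
  proof (cases "i \<in> U")
    case False
    then have "h i \<in> U" using h that by (auto simp: bij_betw_def)
    then show ?thesis using top[of "h i" i] False that assms by (auto simp: \<sigma>_def)
  qed (simp add: \<sigma>_def)
  ultimately show ?thesis by blast
qed

section \<open>Gumbel noise and MNL choice probabilities\<close>

locale gumbel_noise = prob_space M for M :: "'a measure" +
  fixes eps :: "nat \<Rightarrow> 'a \<Rightarrow> real" and n :: nat
  assumes indep: "indep_vars (\<lambda>_. borel) eps {0..n}"
    and gumbel: "\<And>i. i \<in> {0..n} \<Longrightarrow>
      distributed M lborel (eps i) (\<lambda>x. ennreal (std_gumbel_density x))"
begin

lemma eps_measurable: "i \<in> {0..n} \<Longrightarrow> eps i \<in> borel_measurable M"
  using gumbel[of i] by (auto dest: distributed_measurable)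

lemma distr_eps: "i \<in> {0..n} \<Longrightarrow>
    distr M borel (eps i) = density lborel (\<lambda>x. ennreal (std_gumbel_density x))"
  using distributed_distr_eq_density[OF gumbel] 
  by (metis distr_cong sets_lborel)

text \<open>The integral over the tail starting at \<open>a\<close> follows from the antiderivative
  \<open>?F\<close>, which tends to 1; the claim is the complement.\<close>

lemma prob_eps_less:
  assumes "i \<in> {0..n}"
  shows "prob {\<omega> \<in> space M. eps i \<omega> < a} = exp (- exp (- a))"
proof -
  note [measurable] = eps_measurable[OF assms]
  let ?F = "\<lambda>x::real. exp (- exp (- x))"
  have "emeasure M (eps i -` {a..} \<inter> space M)
      = (\<integral>\<^sup>+x. ennreal (std_gumbel_density x) * indicator {a..} x \<partial>lborel)"
    using distributed_emeasure[OF gumbel[OF assms], of "{a..}"] by simp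
  also have "\<dots> = ennreal (1 - ?F a)"
  proof (rule nn_integral_FTC_atLeast)
    show "std_gumbel_density \<in> borel_measurable borel"
      unfolding std_gumbel_density_def[abs_def] by measurable
    show "(?F has_real_derivative std_gumbel_density x) (at x)" for x
      unfolding std_gumbel_density_def by (auto intro!: derivative_eq_intros)
    show "0 \<le> std_gumbel_density x" for x by (simp add: std_gumbel_density_def)
    have "((\<lambda>x::real. exp (- x)) \<longlongrightarrow> 0) at_top"
      by (rule filterlim_compose[OF exp_at_bot filterlim_uminus_at_bot_at_top])
    from tendsto_exp[OF tendsto_minus[OF this]] show "(?F \<longlongrightarrow> 1) at_top" by simp
  qed
  finally have "prob (eps i -` {a..} \<inter> space M) = 1 - ?F a"
    by (simp add: measure_def)
  moreover have "space M - (eps i -` {a..} \<inter> space M) = {\<omega> \<in> space M. eps i \<omega> < a}"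
    by auto
  ultimately show ?thesis
    using prob_compl[of "eps i -` {a..} \<inter> space M"] by simp
qed

lemma prob_all_eps_less:
  assumes "B \<subseteq> {0..n}"
  shows "prob {\<omega> \<in> space M. \<forall>j\<in>B. eps j \<omega> < a j} = exp (- (\<Sum>j\<in>B. exp (- a j)))"
\<comment> \<open>The product rule for independent families asks for a nonempty index set, whereas
  \<open>prob_strict_argmax\<close> includes the case \<open>A = {i}\<close>, where
  \<open>B = {}\<close>.\<close>
proof (cases "B = {}")
  case True
  then show ?thesis by (simp add: prob_space)
next
  case False
  have fin: "finite B" using assms finite_subset by blast
  have "{\<omega> \<in> space M. \<forall>j\<in>B. eps j \<omega> < a j} = (\<Inter>j\<in>B. eps j -` {..<a j} \<inter> space M)"
    using False by auto
  then have "prob {\<omega> \<in> space M. \<forall>j\<in>B. eps j \<omega> < a j} = (\<Prod>j\<in>B. prob (eps j -` {..<a j} \<inter> space M))"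
    using indep_varsD[OF indep False fin assms, of "\<lambda>j. {..<a j}"] by simp
  also have "\<dots> = (\<Prod>j\<in>B. exp (- exp (- a j)))"
  proof (rule prod.cong)
    fix j assume "j \<in> B"
    moreover have "eps j -` {..<a j} \<inter> space M = {\<omega> \<in> space M. eps j \<omega> < a j}" by auto
    ultimately show "prob (eps j -` {..<a j} \<inter> space M) = exp (- exp (- a j))"
      using prob_eps_less[of j "a j"] assms by auto
  qed simp
  also have "\<dots> = exp (\<Sum>j\<in>B. - exp (- a j))"
    using fin by (simp add: exp_sum)
  finally show ?thesis by (simp add: sum_negf)
qed

text \<open>Up to a factor, the product of a Gumbel density and Gumbel distribution functions is the
  density of a shifted Gumbel variable.\<close>

lemma nn_integral_gumbel:
  assumes "0 \<le> W"
  shows "(\<integral>\<^sup>+x. ennreal (std_gumbel_density x) * ennreal (exp (- W * exp (- x))) \<partial>lborel)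
    = ennreal (1 / (1 + W))"
proof -
  have [measurable]: "std_gumbel_density \<in> borel_measurable borel"
    unfolding std_gumbel_density_def[abs_def] by measurable
  have nonneg: "0 \<le> std_gumbel_density x" for x by (simp add: std_gumbel_density_def)
  \<comment> \<open>Multiplying \<open>exp (- x)\<close> by \<open>1 + W\<close> amounts to shifting
    \<open>x\<close> by \<open>L\<close>.\<close>
  define L where "L = ln (1 + W)"
  have L: "exp L = 1 + W" using assms by (simp add: L_def)
  have one: "(\<integral>\<^sup>+x. ennreal (std_gumbel_density x) \<partial>lborel) = 1"
  proof -
    have "emeasure M (eps 0 -` UNIV \<inter> space M) = 1" by (simp add: emeasure_space_1)
    then show ?thesis
      using distributed_emeasure[OF gumbel[of 0], of UNIV] by simp
  qed
  have eq: "std_gumbel_density x * exp (- W * exp (- x))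
      = 1 / (1 + W) * std_gumbel_density (- L + 1 * x)" for x
  proof -
    have "exp (- (- L + 1 * x)) = (1 + W) * exp (- x)"
      using L by (simp add: exp_diff exp_minus divide_inverse)
    then have "std_gumbel_density (- L + 1 * x) = (1 + W) * exp (- x) * exp (- ((1 + W) * exp (- x)))"
      by (simp only: std_gumbel_density_def)
    also have "exp (- ((1 + W) * exp (- x))) = exp (- exp (- x)) * exp (- W * exp (- x))"
      by (simp add: exp_add[symmetric] algebra_simps)
    finally show ?thesis using assms by (simp add: std_gumbel_density_def)
  qed
  have "(\<integral>\<^sup>+x. ennreal (std_gumbel_density x) * ennreal (exp (- W * exp (- x))) \<partial>lborel)
      = (\<integral>\<^sup>+x. ennreal (1 / (1 + W)) * ennreal (std_gumbel_density (- L + 1 * x)) \<partial>lborel)"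
    using assms by (simp only: ennreal_mult[symmetric] eq nonneg
        exp_ge_zero divide_nonneg_nonneg zero_le_one add_nonneg_nonneg)
  also have "\<dots> = ennreal (1 / (1 + W)) * (\<integral>\<^sup>+x. ennreal (std_gumbel_density (- L + 1 * x)) \<partial>lborel)"
    by (rule nn_integral_cmult) measurable
  also have "(\<integral>\<^sup>+x. ennreal (std_gumbel_density (- L + 1 * x)) \<partial>lborel) = 1"
    using nn_integral_real_affine[of "\<lambda>x. ennreal (std_gumbel_density x)" 1 "- L"] one by simp
  finally show ?thesis by simp
qed

text \<open>The MNL formula, by conditioning on \<open>eps i\<close>: given its value
  \<open>x\<close>, each other \<open>eps j\<close> has to stay below \<open>c i - c j + x\<close>,
  and the resulting product of distribution functions is integrated against the density of
  \<open>eps i\<close>.\<close>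

lemma prob_strict_argmax:
  assumes A: "A \<subseteq> {0..n}" and i: "i \<in> A"
  shows "prob {\<omega> \<in> space M. \<forall>j\<in>A - {i}. c j + eps j \<omega> < c i + eps i \<omega>}
    = exp (c i) / (\<Sum>j\<in>A. exp (c j))"
proof -
  have fin: "finite A" using A finite_subset by blast
  define B where "B = A - {i}"
  have B: "B \<subseteq> {0..n}" "finite B" "i \<notin> B" using A fin by (auto simp: B_def)
  have in0: "i \<in> {0..n}" using A i by auto
  have meas[measurable]: "\<And>j. j \<in> B \<Longrightarrow> eps j \<in> borel_measurable M" "eps i \<in> borel_measurable M"
    using eps_measurable B in0 by auto
  let ?P = "PiM B (\<lambda>_. borel :: real measure)"
  let ?Y = "\<lambda>\<omega>. restrict (\<lambda>j. eps j \<omega>) B"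
  have Y: "?Y \<in> measurable M ?P" by (intro measurable_restrict meas)
  let ?I = "PiM {i} (\<lambda>_. borel :: real measure)"
  let ?X = "\<lambda>\<omega>. restrict (\<lambda>j. eps j \<omega>) {i}"
  have X: "?X \<in> measurable M ?I" by (intro measurable_restrict) (use meas in auto)
  have "indep_var ?I ?X ?P ?Y"
    by (rule indep_var_restrict[OF indep]) (use B in0 in auto)
  then have joint: "distr M ?I ?X \<Otimes>\<^sub>M distr M ?P ?Y = distr M (?I \<Otimes>\<^sub>M ?P) (\<lambda>\<omega>. (?X \<omega>, ?Y \<omega>))"
    by (simp add: indep_var_distribution_eq)
  interpret Y: prob_space "distr M ?P ?Y" by (rule prob_space_distr[OF Y])
  define Q where "Q = {p \<in> space (?I \<Otimes>\<^sub>M ?P). \<forall>j\<in>B. c j + snd p j < c i + fst p i}"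
  have Q: "Q \<in> sets (?I \<Otimes>\<^sub>M ?P)" unfolding Q_def using B by measurable
  \<comment> \<open>\<open>W\<close> collects the weights of the competitors relative to that of
    \<open>i\<close>.\<close>
  define W where "W = (\<Sum>j\<in>B. exp (c j - c i))"
  have W: "0 \<le> W" by (simp add: W_def sum_nonneg)
  have slice: "emeasure (distr M ?P ?Y) (Pair x -` Q) = ennreal (exp (- W * exp (- x i)))"
    if x: "x \<in> space ?I" for x
  proof -
    have "emeasure (distr M ?P ?Y) (Pair x -` Q) = emeasure M (?Y -` (Pair x -` Q) \<inter> space M)"
      by (rule emeasure_distr[OF Y sets_Pair1[OF Q]])
    also have "?Y -` (Pair x -` Q) \<inter> space M = {\<omega> \<in> space M. \<forall>j\<in>B. eps j \<omega> < c i - c j + x i}"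
      using measurable_space[OF Y] x by (auto simp: Q_def space_pair_measure algebra_simps)
    also have "emeasure M \<dots> = ennreal (exp (- (\<Sum>j\<in>B. exp (- (c i - c j + x i)))))"
      by (subst emeasure_eq_measure, subst prob_all_eps_less[OF B(1)]) simp
    also have "(\<Sum>j\<in>B. exp (- (c i - c j + x i))) = W * exp (- x i)"
      unfolding W_def sum_distrib_right by (intro sum.cong) (simp_all add: exp_add[symmetric])
    finally show ?thesis by (simp only: mult_minus_left)
  qed
  have "emeasure M {\<omega> \<in> space M. \<forall>j\<in>B. c j + eps j \<omega> < c i + eps i \<omega>}
      = emeasure (distr M (?I \<Otimes>\<^sub>M ?P) (\<lambda>\<omega>. (?X \<omega>, ?Y \<omega>))) Q"
    using Q X Y measurable_space[OF X] measurable_space[OF Y]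
    by (subst emeasure_distr)
      (auto simp: Q_def space_pair_measure intro!: arg_cong[where f = "emeasure M"])
  also have "\<dots> = (\<integral>\<^sup>+x. emeasure (distr M ?P ?Y) (Pair x -` Q) \<partial>distr M ?I ?X)"
    unfolding joint[symmetric] by (rule Y.emeasure_pair_measure_alt) (use Q in simp)
  also have "\<dots> = (\<integral>\<^sup>+x. ennreal (exp (- W * exp (- x i))) \<partial>distr M ?I ?X)"
    by (intro nn_integral_cong slice) simp
  also have "\<dots> = (\<integral>\<^sup>+\<omega>. ennreal (exp (- W * exp (- eps i \<omega>))) \<partial>M)"
    by (subst nn_integral_distr[OF X]) simp_all
  also have "\<dots> = (\<integral>\<^sup>+x. ennreal (exp (- W * exp (- x))) \<partial>distr M borel (eps i))"
    by (subst nn_integral_distr) simp_all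
  also have "\<dots> = (\<integral>\<^sup>+x. ennreal (std_gumbel_density x) * ennreal (exp (- W * exp (- x))) \<partial>lborel)"
    unfolding distr_eps[OF in0]
    by (rule nn_integral_density) (simp_all add: std_gumbel_density_def[abs_def])
  also have "\<dots> = ennreal (1 / (1 + W))" by (rule nn_integral_gumbel[OF W])
  finally have "prob {\<omega> \<in> space M. \<forall>j\<in>B. c j + eps j \<omega> < c i + eps i \<omega>} = 1 / (1 + W)"
    using W by (simp add: measure_def)
  also have "\<dots> = exp (c i) / (exp (c i) * (1 + W))" by simp
  also have "exp (c i) * (1 + W) = (\<Sum>j\<in>A. exp (c j))"
  proof -
    have "(\<Sum>j\<in>A. exp (c j)) = exp (c i) + (\<Sum>j\<in>B. exp (c j))"
      unfolding B_def using fin i by (rule sum.remove)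
    also have "(\<Sum>j\<in>B. exp (c j)) = exp (c i) * W"
      unfolding W_def sum_distrib_left by (intro sum.cong) (simp_all add: exp_add[symmetric])
    finally show ?thesis by (simp add: algebra_simps)
  qed
  finally show ?thesis by (simp add: B_def)
qed

text \<open>Ties are null because the probabilities of the strict maximizers already add up to 1.\<close>

lemma AE_ex_strict_argmax:
  assumes A: "A \<subseteq> {0..n}" "A \<noteq> {}"
  shows "AE \<omega> in M. \<exists>i\<in>A. \<forall>j\<in>A - {i}. c j + eps j \<omega> < c i + eps i \<omega>"
proof -
  have fin: "finite A" using A finite_subset by blast
  have meas[measurable]: "\<And>j. j \<in> A \<Longrightarrow> eps j \<in> borel_measurable M"
    using eps_measurable A by auto
  define E where "E i = {\<omega> \<in> space M. \<forall>j\<in>A - {i}. c j + eps j \<omega> < c i + eps i \<omega>}" for i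
  have E: "E i \<in> events" if "i \<in> A" for i
    unfolding E_def using fin that by measurable
  have "disjoint_family_on E A"
    unfolding disjoint_family_on_def
  proof (intro ballI impI)
    fix i j assume ij: "i \<in> A" "j \<in> A" "i \<noteq> j"
    show "E i \<inter> E j = {}"
    proof (intro equals0I)
      fix \<omega> assume "\<omega> \<in> E i \<inter> E j"
      then have "c j + eps j \<omega> < c i + eps i \<omega>" "c i + eps i \<omega> < c j + eps j \<omega>"
        using ij by (auto simp: E_def)
      then show False by simp
    qed
  qed
  then have "prob (\<Union>i\<in>A. E i) = (\<Sum>i\<in>A. prob (E i))"
    using fin E by (intro finite_measure_finite_Union) auto
  also have "\<dots> = (\<Sum>i\<in>A. exp (c i) / (\<Sum>j\<in>A. exp (c j)))"
    unfolding E_def using A by (intro sum.cong refl prob_strict_argmax)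
  also have "\<dots> = 1"
    using fin A sum_pos[of A "\<lambda>j. exp (c j)"] by (simp add: sum_divide_distrib[symmetric])
  finally have "AE \<omega> in M. \<omega> \<in> (\<Union>i\<in>A. E i)"
    using fin E by (subst AE_in_set_eq_1) auto
  then show ?thesis by eventually_elim (auto simp: E_def)
qed

section \<open>Exchanging products\<close>

text \<open>A coupling: assigning to each \<open>i\<close> in \<open>T\<close> the noise of
  \<open>\<sigma> i\<close> does not change the law, and after that every product of
  \<open>T\<close> is dominated pointwise by its image, so at least as many products of
  \<open>U\<close> reach the level.\<close>

lemma prob_ge_opaque_mono:
  assumes T: "T \<subseteq> {1..n}" "T \<noteq> {}" and U: "U \<subseteq> {1..n}" and k: "1 \<le> k"
    and bij: "bij_betw \<sigma> T U" and le: "\<And>i. i \<in> T \<Longrightarrow> v i \<le> v (\<sigma> i)"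
  shows "prob {\<omega> \<in> space M. eps 0 \<omega> + \<rho> \<le> opaque_valuation v k T (\<lambda>l. eps l \<omega>)}
    \<le> prob {\<omega> \<in> space M. eps 0 \<omega> + \<rho> \<le> opaque_valuation v k U (\<lambda>l. eps l \<omega>)}"
proof -
  have fin: "finite T" "finite U" using T U finite_subset by blast+
  have U': "U \<noteq> {}" and card: "card U = card T"
    using bij T by (auto simp: bij_betw_def dest: bij_betw_same_card)
      (metis bij bij_betw_same_card)
  \<comment> \<open>The extension leaves 0 fixed, so the noise of the no-purchase option is kept; it
    stays injective because 0 is not in \<open>U\<close>.\<close>
  define \<tau> where "\<tau> i = (if i \<in> T then \<sigma> i else i)" for i
  let ?J = "insert 0 T"
  have T0: "0 \<notin> T" "0 \<notin> U" using T U by auto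
  have \<sigma>: "\<sigma> i \<in> U" if "i \<in> T" for i using bij that by (auto simp: bij_betw_def)
  have \<tau>: "\<tau> i \<in> {0..n}" if "i \<in> ?J" for i
    using \<sigma>[of i] U that T0 by (cases "i \<in> T") (auto simp: \<tau>_def)
  have inj: "inj_on \<tau> ?J"
  proof (rule inj_onI)
    fix i j assume ij: "i \<in> ?J" "j \<in> ?J" "\<tau> i = \<tau> j"
    have \<tau>0: "\<tau> 0 = 0" "\<And>i. i \<in> T \<Longrightarrow> \<tau> i = \<sigma> i" "\<And>i. i \<in> T \<Longrightarrow> \<sigma> i \<noteq> 0"
      using T0 \<sigma> unfolding \<tau>_def by metis+
    show "i = j"
    proof (cases "i = 0 \<or> j = 0")
      case True
      then show ?thesis using ij \<tau>0 by fastforce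
    next
      case False
      then have "i \<in> T" "j \<in> T" "\<sigma> i = \<sigma> j" using ij \<tau>0 by auto
      then show ?thesis using bij by (auto simp: bij_betw_def dest: inj_onD)
    qed
  qed
  have J: "?J \<subseteq> {0..n}" using T by auto
  let ?P = "PiM ?J (\<lambda>_. borel :: real measure)"
  define X where "X \<tau> = (\<lambda>\<omega>. restrict (\<lambda>i. eps (\<tau> i) \<omega>) ?J)" for \<tau>
  define G where "G = density lborel (\<lambda>x. ennreal (std_gumbel_density x))"
  \<comment> \<open>Stated for any injective reindexing, as it serves both the \<open>\<tau>\<close>
    defined above and the identity: either way the noise vector consists of independent Gumbel
    variables.\<close>
  have X: "X \<tau> \<in> measurable M ?P" "distr M ?P (X \<tau>) = PiM ?J (\<lambda>_. G)"
    if "inj_on \<tau> ?J" "\<And>i. i \<in> ?J \<Longrightarrow> \<tau> i \<in> {0..n}" for \<tau>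
  proof -
    have rv: "\<And>i. i \<in> ?J \<Longrightarrow> eps (\<tau> i) \<in> borel_measurable M"
      using that eps_measurable by blast
    then show "X \<tau> \<in> measurable M ?P" unfolding X_def by (intro measurable_restrict)
    have "indep_vars (\<lambda>_. borel) (\<lambda>i. eps (\<tau> i)) ?J"
      using that by (intro indep_vars_reindex_inj[OF indep]) auto
    then have "distr M ?P (X \<tau>) = PiM ?J (\<lambda>i. distr M borel (eps (\<tau> i)))"
      unfolding X_def using rv
      by (subst indep_vars_iff_distr_eq_PiM'[symmetric]) auto
    also have "\<dots> = PiM ?J (\<lambda>_. G)"
      using that by (intro PiM_cong) (simp_all only: G_def distr_eps)
    finally show "distr M ?P (X \<tau>) = PiM ?J (\<lambda>_. G)" .
  qed
  define Z where "Z = {x \<in> space ?P. x 0 + \<rho> \<le> opaque_valuation v k T (\<lambda>l. x l)}"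
  have [measurable]: "(\<lambda>x. opaque_valuation v k T (\<lambda>l. x l)) \<in> borel_measurable ?P"
    using fin T k by (intro measurable_opaque_valuation) simp_all
  have Z: "Z \<in> sets ?P" unfolding Z_def by measurable
  have pr: "prob {\<omega> \<in> space M. eps (\<tau> 0) \<omega> + \<rho> \<le> opaque_valuation v k T (\<lambda>l. eps (\<tau> l) \<omega>)}
      = measure (PiM ?J (\<lambda>_. G)) Z"
    if *: "inj_on \<tau> ?J" "\<And>i. i \<in> ?J \<Longrightarrow> \<tau> i \<in> {0..n}" for \<tau>
  proof -
    have "opaque_valuation v k T (\<lambda>l. X \<tau> \<omega> l) = opaque_valuation v k T (\<lambda>l. eps (\<tau> l) \<omega>)" for \<omega>
      using fin T k by (intro opaque_valuation_cong) (auto simp: X_def)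
    then have "{\<omega> \<in> space M. eps (\<tau> 0) \<omega> + \<rho> \<le> opaque_valuation v k T (\<lambda>l. eps (\<tau> l) \<omega>)}
        = X \<tau> -` Z \<inter> space M"
      using measurable_space[OF X(1)[OF *]] by (auto simp: Z_def) (simp_all add: X_def)
    then show ?thesis using measure_distr[OF X(1)[OF *] Z] X(2)[OF *] by simp
  qed
  have "prob {\<omega> \<in> space M. eps 0 \<omega> + \<rho> \<le> opaque_valuation v k T (\<lambda>l. eps l \<omega>)}
      = prob {\<omega> \<in> space M. eps (\<tau> 0) \<omega> + \<rho> \<le> opaque_valuation v k T (\<lambda>l. eps (\<tau> l) \<omega>)}"
    using pr[of \<tau>, OF inj \<tau>] pr[of "\<lambda>i. i", OF inj_on_id2 subsetD[OF J]] by simp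
  also have "\<dots> \<le> prob {\<omega> \<in> space M. eps 0 \<omega> + \<rho> \<le> opaque_valuation v k U (\<lambda>l. eps l \<omega>)}"
  proof (rule finite_measure_mono)
    have [measurable]: "eps 0 \<in> borel_measurable M"
        "(\<lambda>\<omega>. opaque_valuation v k U (\<lambda>l. eps l \<omega>)) \<in> borel_measurable M"
      using fin U U' k by (auto intro!: measurable_opaque_valuation eps_measurable)
    show "{\<omega> \<in> space M. eps 0 \<omega> + \<rho> \<le> opaque_valuation v k U (\<lambda>l. eps l \<omega>)} \<in> events"
      by measurable
    show "{\<omega> \<in> space M. eps (\<tau> 0) \<omega> + \<rho> \<le> opaque_valuation v k T (\<lambda>l. eps (\<tau> l) \<omega>)}
      \<subseteq> {\<omega> \<in> space M. eps 0 \<omega> + \<rho> \<le> opaque_valuation v k U (\<lambda>l. eps l \<omega>)}"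
    proof clarify
      fix \<omega> assume "eps (\<tau> 0) \<omega> + \<rho> \<le> opaque_valuation v k T (\<lambda>l. eps (\<tau> l) \<omega>)"
      moreover have "\<tau> 0 = 0" using T0 by (simp add: \<tau>_def)
      ultimately have "max 1 (Suc (card T) - k)
          \<le> card {i \<in> T. eps 0 \<omega> + \<rho> \<le> valuation v (\<lambda>l. eps (\<tau> l) \<omega>) i}"
        using le_opaque_valuation_iff fin T k by simp
      \<comment> \<open>Injectivity keeps the count, and \<open>card U = card T\<close> makes the
        threshold for \<open>U\<close> the same.\<close>
      also have "\<dots> = card (\<sigma> ` {i \<in> T. eps 0 \<omega> + \<rho> \<le> valuation v (\<lambda>l. eps (\<tau> l) \<omega>) i})"
        using bij by (intro card_image[symmetric]) (auto simp: bij_betw_def inj_on_def)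
      also have "\<dots> \<le> card {i \<in> U. eps 0 \<omega> + \<rho> \<le> valuation v (\<lambda>l. eps l \<omega>) i}"
      proof (rule card_mono)
        have "valuation v (\<lambda>l. eps (\<tau> l) \<omega>) i \<le> valuation v (\<lambda>l. eps l \<omega>) (\<sigma> i)" if "i \<in> T" for i
        proof -
          have "i \<noteq> 0" "\<sigma> i \<noteq> 0" using that T0 \<sigma> by metis+
          then show ?thesis using le that by (simp add: valuation_def \<tau>_def)
        qed
        then show "\<sigma> ` {i \<in> T. eps 0 \<omega> + \<rho> \<le> valuation v (\<lambda>l. eps (\<tau> l) \<omega>) i}
            \<subseteq> {i \<in> U. eps 0 \<omega> + \<rho> \<le> valuation v (\<lambda>l. eps l \<omega>) i}"
          using \<sigma> by (auto intro: order_trans)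
      qed (use fin in simp)
      finally show "eps 0 \<omega> + \<rho> \<le> opaque_valuation v k U (\<lambda>l. eps l \<omega>)"
        using le_opaque_valuation_iff fin U' k card by simp
    qed
  qed
  finally show ?thesis .
qed

section \<open>Bounds on choice probabilities and revenues\<close>

text \<open>Some product of \<open>S\<close> is valued at least as much as the opaque product and is
  strictly cheaper, so it is preferred.\<close>

lemma opaque_choice_prob_eq_0:
  assumes "finite S" "S \<noteq> {}" "1 \<le> k" "\<And>i. i \<in> S \<Longrightarrow> r i < \<rho>" "0 \<notin> S"
  shows "opaque_choice_prob M eps v k S r \<rho> = 0"
proof -
  have "{\<omega> \<in> space M. \<forall>j \<in> insert 0 S.
      utility v r (\<lambda>l. eps l \<omega>) j \<le> opaque_utility v k S \<rho> (\<lambda>l. eps l \<omega>)} = {}"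
  proof (intro equals0I)
    fix \<omega>
    assume \<omega>: "\<omega> \<in> {\<omega> \<in> space M. \<forall>j \<in> insert 0 S.
      utility v r (\<lambda>l. eps l \<omega>) j \<le> opaque_utility v k S \<rho> (\<lambda>l. eps l \<omega>)}"
    obtain i where i: "i \<in> S"
        "opaque_valuation v k S (\<lambda>l. eps l \<omega>) \<le> valuation v (\<lambda>l. eps l \<omega>) i"
      using opaque_valuation_le_Max[OF assms(1-3)] by blast
    moreover have "i \<noteq> 0" using i assms by metis
    ultimately show False using \<omega> assms(4)[of i] by (auto simp: utility_def opaque_utility_def)
  qed
  then show ?thesis unfolding opaque_choice_prob_def by (simp only: measure_empty)
qed

text \<open>Whenever the opaque product is bought, every product of \<open>S\<close> whose valuation is at least
  that of the opaque product costs at least \<open>\<rho>\<close>.\<close>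

lemma opaque_choice_prob_le:
  assumes S: "S \<subseteq> {1..n}" and T: "T = {i \<in> S. \<rho> \<le> r i}" "T \<noteq> {}" and k: "1 \<le> k"
  shows "opaque_choice_prob M eps v k S r \<rho>
    \<le> prob {\<omega> \<in> space M. eps 0 \<omega> + \<rho> \<le> opaque_valuation v k T (\<lambda>l. eps l \<omega>)}"
  unfolding opaque_choice_prob_def
proof (rule finite_measure_mono)
  have TS: "T \<subseteq> S" using T by auto
  have fin: "finite S" "finite T"
    using S TS finite_subset[of _ "{1..n}"] by (blast intro: finite_atLeastAtMost)+
  have S': "S \<noteq> {}" "0 \<notin> S" using T S by auto
  have T': "T \<subseteq> {1..n}" using TS S by auto
  have [measurable]: "eps 0 \<in> borel_measurable M"
      "(\<lambda>\<omega>. opaque_valuation v k T (\<lambda>l. eps l \<omega>)) \<in> borel_measurable M"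
    using fin T' T(2) k by (auto intro!: measurable_opaque_valuation eps_measurable)
  show "{\<omega> \<in> space M. eps 0 \<omega> + \<rho> \<le> opaque_valuation v k T (\<lambda>l. eps l \<omega>)} \<in> events"
    by measurable
  show "{\<omega> \<in> space M. \<forall>j \<in> insert 0 S.
        utility v r (\<lambda>l. eps l \<omega>) j \<le> opaque_utility v k S \<rho> (\<lambda>l. eps l \<omega>)}
    \<subseteq> {\<omega> \<in> space M. eps 0 \<omega> + \<rho> \<le> opaque_valuation v k T (\<lambda>l. eps l \<omega>)}"
  proof clarify
    fix \<omega>
    assume *: "\<forall>j \<in> insert 0 S.
        utility v r (\<lambda>l. eps l \<omega>) j \<le> opaque_utility v k S \<rho> (\<lambda>l. eps l \<omega>)"
    let ?V = "valuation v (\<lambda>l. eps l \<omega>)" and ?q = "opaque_valuation v k S (\<lambda>l. eps l \<omega>)"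
    have 0: "eps 0 \<omega> + \<rho> \<le> ?q"
      using * by (simp add: utility_def opaque_utility_def valuation_def)
    have sub: "{i \<in> S. ?q \<le> ?V i} \<subseteq> {i \<in> T. eps 0 \<omega> + \<rho> \<le> ?V i}"
    proof clarify
      fix i assume i: "i \<in> S" "?q \<le> ?V i"
      then have "i \<noteq> 0" using S' by metis
      moreover have "utility v r (\<lambda>l. eps l \<omega>) i \<le> opaque_utility v k S \<rho> (\<lambda>l. eps l \<omega>)"
        using * i by blast
      ultimately have "?V i - r i \<le> ?q - \<rho>"
        by (simp add: utility_def opaque_utility_def)
      then show "i \<in> T \<and> eps 0 \<omega> + \<rho> \<le> ?V i" using i 0 by (auto simp: T)
    qed
    \<comment> \<open>The threshold grows with the number of products, so the smaller set
      \<open>T\<close> demands no more high valuations than \<open>S\<close>.\<close>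
    have "max 1 (Suc (card T) - k) \<le> max 1 (Suc (card S) - k)"
      using card_mono[OF fin(1) TS] by auto
    also have "\<dots> \<le> card {i \<in> S. ?q \<le> ?V i}"
      using le_opaque_valuation_iff[OF fin(1) S'(1) k, of ?q v "\<lambda>l. eps l \<omega>"] by simp
    also have "\<dots> \<le> card {i \<in> T. eps 0 \<omega> + \<rho> \<le> ?V i}"
      using fin sub by (intro card_mono) auto
    finally show "eps 0 \<omega> + \<rho> \<le> opaque_valuation v k T (\<lambda>l. eps l \<omega>)"
      using le_opaque_valuation_iff[OF fin(2) T(2) k] by simp
  qed
qed

lemma utility_measurable:
  "i \<in> {0..n} \<Longrightarrow> (\<lambda>\<omega>. utility v r (\<lambda>l. eps l \<omega>) i) \<in> borel_measurable M"
  using eps_measurable[of i] unfolding utility_def valuation_def by (cases "i = 0") simp_all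

lemma opaque_utility_measurable:
  assumes "S \<subseteq> {1..n}" "S \<noteq> {}" "1 \<le> k"
  shows "(\<lambda>\<omega>. opaque_utility v k S \<rho> (\<lambda>l. eps l \<omega>)) \<in> borel_measurable M"
proof -
  have "finite S" using assms finite_subset by blast
  then have [measurable]: "(\<lambda>\<omega>. opaque_valuation v k S (\<lambda>l. eps l \<omega>)) \<in> borel_measurable M"
    using assms by (intro measurable_opaque_valuation eps_measurable) auto
  show ?thesis unfolding opaque_utility_def by measurable
qed

lemma prob_strict_argmax_utility:
  assumes S: "S \<subseteq> {1..n}" and i: "i \<in> S"
  shows "prob {\<omega> \<in> space M. \<forall>j \<in> insert 0 S - {i}.
      utility v r (\<lambda>l. eps l \<omega>) j < utility v r (\<lambda>l. eps l \<omega>) i}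
    = exp (v i - r i) / (1 + (\<Sum>j\<in>S. exp (v j - r j)))"
proof -
  \<comment> \<open>The values \<open>v 0\<close> and \<open>r 0\<close> are arbitrary, so the
    offset of the no-purchase option is set to 0 explicitly.\<close>
  define c where "c j = (if j = 0 then 0 else v j - r j)" for j
  have fin: "finite S" using S finite_subset by blast
  have u: "utility v r (\<lambda>l. eps l \<omega>) j = c j + eps j \<omega>" for j \<omega>
    by (simp add: utility_def valuation_def c_def)
  have "(\<Sum>j\<in>insert 0 S. exp (c j)) = 1 + (\<Sum>j\<in>S. exp (c j))"
    using S fin by (subst sum.insert) (auto simp: c_def)
  also have "(\<Sum>j\<in>S. exp (c j)) = (\<Sum>j\<in>S. exp (v j - r j))"
    using S by (intro sum.cong) (auto simp: c_def)
  finally have "(\<Sum>j\<in>insert 0 S. exp (c j)) = 1 + (\<Sum>j\<in>S. exp (v j - r j))" .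
  moreover have "c i = v i - r i" using S i by (auto simp: c_def)
  ultimately show ?thesis
    unfolding u using S i by (subst prob_strict_argmax[of "insert 0 S" i c]) auto
qed

text \<open>Omitting the comparison with the opaque product enlarges the event; what remains is
  plain MNL choice.\<close>

lemma choice_prob_le:
  assumes S: "S \<subseteq> {1..n}" and i: "i \<in> S"
  shows "choice_prob M eps v k S r \<rho> i \<le> exp (v i - r i) / (1 + (\<Sum>j\<in>S. exp (v j - r j)))"
  unfolding choice_prob_def prob_strict_argmax_utility[OF S i, symmetric]
proof (rule finite_measure_mono)
  have fin: "finite S" using S finite_subset by blast
  have "0 \<in> {0..n}" by simp
  note [measurable] = utility_measurable[OF this]
  have [measurable]: "\<And>i. i \<in> S \<Longrightarrow> (\<lambda>\<omega>. utility v r (\<lambda>l. eps l \<omega>) i) \<in> borel_measurable M"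
    using S by (intro utility_measurable) auto
  show "{\<omega> \<in> space M. \<forall>j \<in> insert 0 S - {i}.
      utility v r (\<lambda>l. eps l \<omega>) j < utility v r (\<lambda>l. eps l \<omega>) i} \<in> events"
    using fin i by (measurable; auto)
qed auto

text \<open>Some product of \<open>S\<close> is valued at least as much as the opaque one and is
  strictly cheaper, so beating all other options of \<open>S\<close> includes beating the opaque
  product.\<close>

lemma opq_rev_high_price:
  assumes S: "S \<subseteq> {1..n}" and k: "1 \<le> k" and \<rho>: "\<And>i. i \<in> S \<Longrightarrow> r i < \<rho>"
  shows "opq_rev M eps v k r S \<rho> = mnl_rev v r S"
proof (cases "S = {}")
  case True
  then show ?thesis by (simp add: opq_rev_def mnl_rev_def)
next
  case False
  have fin: "finite S" and S0: "0 \<notin> S" using S finite_subset by auto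
  have "choice_prob M eps v k S r \<rho> i = exp (v i - r i) / (1 + (\<Sum>j\<in>S. exp (v j - r j)))"
    if i: "i \<in> S" for i
    unfolding choice_prob_def prob_strict_argmax_utility[OF S i, symmetric]
  proof (rule arg_cong[where f = prob], intro Collect_cong conj_cong refl iffI, elim conjunct2)
    fix \<omega>
    assume *: "\<forall>j \<in> insert 0 S - {i}.
      utility v r (\<lambda>l. eps l \<omega>) j < utility v r (\<lambda>l. eps l \<omega>) i"
    obtain l where l: "l \<in> S"
        "opaque_valuation v k S (\<lambda>l. eps l \<omega>) \<le> valuation v (\<lambda>l. eps l \<omega>) l"
      using opaque_valuation_le_Max[OF fin False k] by blast
    have "l \<noteq> 0" using l S0 by metis
    then have "opaque_utility v k S \<rho> (\<lambda>l. eps l \<omega>) < utility v r (\<lambda>l. eps l \<omega>) l"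
      using l \<rho>[of l] by (simp add: utility_def opaque_utility_def)
    also have "\<dots> \<le> utility v r (\<lambda>l. eps l \<omega>) i" using * l by (cases "l = i") (auto intro: less_imp_le)
    finally show "opaque_utility v k S \<rho> (\<lambda>l. eps l \<omega>) < utility v r (\<lambda>l. eps l \<omega>) i \<and>
      (\<forall>j \<in> insert 0 S - {i}.
        utility v r (\<lambda>l. eps l \<omega>) j < utility v r (\<lambda>l. eps l \<omega>) i)"
      using * by blast
  qed
  then show ?thesis
    using False opaque_choice_prob_eq_0[OF fin False k \<rho> S0]
    by (simp add: opq_rev_def mnl_rev_def sum_divide_distrib)
qed

text \<open>If all prices are at least \<open>\<rho>\<close>, every purchase earns at least \<open>\<rho>\<close>, and a
  purchase takes place whenever the opaque product is preferred to not buying.\<close>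

lemma opq_rev_ge:
  assumes U: "U \<subseteq> {1..n}" "U \<noteq> {}" and k: "1 \<le> k"
    and \<rho>: "0 \<le> \<rho>" "\<And>i. i \<in> U \<Longrightarrow> \<rho> \<le> r i"
  shows "\<rho> * prob {\<omega> \<in> space M. eps 0 \<omega> + \<rho> \<le> opaque_valuation v k U (\<lambda>l. eps l \<omega>)}
    \<le> opq_rev M eps v k r U \<rho>"
proof -
  have fin: "finite U" using U finite_subset by blast
  let ?u = "\<lambda>\<omega>. utility v r (\<lambda>l. eps l \<omega>)" and ?q = "\<lambda>\<omega>. opaque_utility v k U \<rho> (\<lambda>l. eps l \<omega>)"
  define Q where "Q = {\<omega> \<in> space M. \<forall>j \<in> insert 0 U. ?u \<omega> j \<le> ?q \<omega>}"
  define C where "C i = {\<omega> \<in> space M. ?q \<omega> < ?u \<omega> i \<and>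
    (\<forall>j \<in> insert 0 U - {i}. ?u \<omega> j < ?u \<omega> i)}" for i
  have [measurable]: "(\<lambda>\<omega>. ?u \<omega> 0) \<in> borel_measurable M"
      "\<And>i. i \<in> insert 0 U \<Longrightarrow> (\<lambda>\<omega>. ?u \<omega> i) \<in> borel_measurable M"
      "\<And>i. i \<in> U \<Longrightarrow> (\<lambda>\<omega>. ?u \<omega> i) \<in> borel_measurable M"
      "?q \<in> borel_measurable M"
    using U k by (auto intro!: utility_measurable opaque_utility_measurable)
  have Q: "Q \<in> events" unfolding Q_def using fin by measurable
  have C: "C i \<in> events" if "i \<in> U" for i
    unfolding C_def using fin that by (measurable; auto)
  have CU: "(\<Union>i\<in>U. C i) \<in> events" using C fin by auto
  \<comment> \<open>Almost surely some option of \<open>insert 0 U\<close> is strictly best. On the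
    event considered, the opaque product is at least as good as not buying, so either it is chosen
    or that best option is a product and is bought.\<close>
  have "AE \<omega> in M. \<exists>i\<in>insert 0 U. \<forall>j\<in>insert 0 U - {i}.
      (if j = 0 then 0 else v j - r j) + eps j \<omega> < (if i = 0 then 0 else v i - r i) + eps i \<omega>"
    using U by (intro AE_ex_strict_argmax) auto
  then have "AE \<omega> in M. \<exists>i\<in>insert 0 U. \<forall>j\<in>insert 0 U - {i}. ?u \<omega> j < ?u \<omega> i"
  proof eventually_elim
    case (elim \<omega>)
    have "?u \<omega> j = (if j = 0 then 0 else v j - r j) + eps j \<omega>" for j
      by (simp add: utility_def valuation_def)
    then show ?case using elim by simp
  qed
  then have "AE \<omega> in M. \<omega> \<in> {\<omega> \<in> space M. eps 0 \<omega> + \<rho> \<le> opaque_valuation v k U (\<lambda>l. eps l \<omega>)}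
      \<longrightarrow> \<omega> \<in> Q \<union> (\<Union>i\<in>U. C i)"
  proof eventually_elim
    case (elim \<omega>)
    then obtain i where i: "i \<in> insert 0 U" "\<forall>j\<in>insert 0 U - {i}. ?u \<omega> j < ?u \<omega> i" by blast
    show ?case
    proof
      assume *: "\<omega> \<in> {\<omega> \<in> space M. eps 0 \<omega> + \<rho> \<le> opaque_valuation v k U (\<lambda>l. eps l \<omega>)}"
      then have q0: "?u \<omega> 0 \<le> ?q \<omega>"
        by (simp add: utility_def opaque_utility_def valuation_def)
      show "\<omega> \<in> Q \<union> (\<Union>i\<in>U. C i)"
      proof (cases "?u \<omega> i \<le> ?q \<omega>")
        case True
        have "?u \<omega> j \<le> ?q \<omega>" if "j \<in> insert 0 U" for j
          using i(2) that True by (cases "j = i") (auto intro: less_imp_le less_le_trans)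
        then show ?thesis using * by (simp add: Q_def)
      next
        case False
        then have "i \<in> U" using i(1) q0 by auto
        moreover have "\<omega> \<in> C i" using False i * by (simp add: C_def)
        ultimately show ?thesis by blast
      qed
    qed
  qed
  then have "prob {\<omega> \<in> space M. eps 0 \<omega> + \<rho> \<le> opaque_valuation v k U (\<lambda>l. eps l \<omega>)}
      \<le> prob (Q \<union> (\<Union>i\<in>U. C i))"
    using Q CU by (intro finite_measure_mono_AE) auto
  also have "\<dots> \<le> prob Q + prob (\<Union>i\<in>U. C i)"
    using Q CU by (intro measure_Un_le) auto
  also have "prob (\<Union>i\<in>U. C i) \<le> (\<Sum>i\<in>U. prob (C i))"
    using fin C by (intro finite_measure_subadditive_finite) auto
  finally have "\<rho> * prob {\<omega> \<in> space M. eps 0 \<omega> + \<rho> \<le> opaque_valuation v k U (\<lambda>l. eps l \<omega>)}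
      \<le> \<rho> * (prob Q + (\<Sum>i\<in>U. prob (C i)))"
    using \<rho> by (intro mult_left_mono) auto
  also have "\<dots> \<le> \<rho> * prob Q + (\<Sum>i\<in>U. r i * prob (C i))"
    unfolding distrib_left sum_distrib_left
    using \<rho> by (intro add_left_mono sum_mono mult_right_mono) auto
  also have "\<dots> = opq_rev M eps v k r U \<rho>"
    using U(2) by (simp add: opq_rev_def choice_prob_def opaque_choice_prob_def Q_def C_def)
  finally show ?thesis .
qed

text \<open>A supremum of reals bounds its members once they are bounded above. Here
  \<open>2 * sum r S\<close> is a bound: probabilities are at most 1, and the opaque product sells
  only if \<open>\<rho>\<close> does not exceed some \<open>r i\<close>.\<close>

lemma opq_rev_le_opt:
  assumes S: "S \<subseteq> {1..n}" and k: "1 \<le> k" and r: "\<And>i. i \<in> S \<Longrightarrow> 0 \<le> r i" and \<rho>: "0 \<le> \<rho>"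
  shows "opq_rev M eps v k r S \<rho> \<le> opq_rev_opt M eps v k r S"
  unfolding opq_rev_opt_def
proof (rule cSUP_upper)
  have fin: "finite S" and S0: "0 \<notin> S" using S finite_subset by auto
  have "opq_rev M eps v k r S \<rho> \<le> sum r S + sum r S" if \<rho>: "\<rho> \<ge> 0" for \<rho>
  proof (cases "S = {}")
    case False
    have "(\<Sum>i\<in>S. r i * choice_prob M eps v k S r \<rho> i) \<le> (\<Sum>i\<in>S. r i * 1)"
      using r by (intro sum_mono mult_left_mono) (auto simp: choice_prob_def)
    moreover have "\<rho> * opaque_choice_prob M eps v k S r \<rho> \<le> sum r S"
    proof (cases "\<forall>i\<in>S. r i < \<rho>")
      case True
      then show ?thesis using opaque_choice_prob_eq_0[OF fin False k _ S0] r
        by (simp add: sum_nonneg)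
    next
      case notless: False
      then obtain i where i: "i \<in> S" "\<rho> \<le> r i" by (auto simp: not_less)
      have "\<rho> * opaque_choice_prob M eps v k S r \<rho> \<le> \<rho> * 1"
        using \<rho> by (intro mult_left_mono) (auto simp: opaque_choice_prob_def)
      also have "\<dots> \<le> r i" using i by simp
      also have "\<dots> \<le> sum r S" using i r fin by (intro member_le_sum) auto
      finally show ?thesis .
    qed
    ultimately show ?thesis using False by (simp add: opq_rev_def)
  qed (simp add: opq_rev_def)
  then show "bdd_above (opq_rev M eps v k r S ` {0..})" by (auto intro!: bdd_aboveI)
qed (use \<rho> in simp)

lemma mnl_rev_le_opt:
  assumes S: "S \<subseteq> {1..n}" and k: "1 \<le> k" and r: "\<And>i. i \<in> S \<Longrightarrow> 0 \<le> r i"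
  shows "mnl_rev v r S \<le> opq_rev_opt M eps v k r S"
proof -
  have fin: "finite S" using S finite_subset by blast
  have "r i < 1 + sum r S" if "i \<in> S" for i
    using member_le_sum[of i S r] that fin r by force
  moreover have "0 \<le> 1 + sum r S" using r by (simp add: sum_nonneg)
  ultimately show ?thesis
    using opq_rev_high_price[OF S k, of r "1 + sum r S" v]
      opq_rev_le_opt[where r = r and \<rho> = "1 + sum r S" and v = v, OF S k] r by simp
qed

lemma opq_rev_opt_nonneg:
  assumes S: "S \<subseteq> {1..n}" and k: "1 \<le> k" and r: "\<And>i. i \<in> S \<Longrightarrow> 0 \<le> r i"
  shows "0 \<le> opq_rev_opt M eps v k r S"
proof -
  have "0 \<le> mnl_rev v r S"
    unfolding mnl_rev_def using r
    by (intro divide_nonneg_nonneg sum_nonneg add_nonneg_nonneg mult_nonneg_nonneg) auto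
  also have "\<dots> \<le> opq_rev_opt M eps v k r S" using S k r by (rule mnl_rev_le_opt)
  finally show ?thesis .
qed

lemma opq_rev_opt_empty: "opq_rev_opt M eps v k r {} = 0"
  by (simp add: opq_rev_opt_def opq_rev_def)

text \<open>With one product the opaque product is that product at another price, so all sales occur
  at the lower of \<open>\<rho>\<close> and \<open>r c\<close>. That price, used as opaque price for
  \<open>a\<close>, does not exceed \<open>r a\<close> and leads to a purchase at least as
  often.\<close>

lemma opq_rev_opt_singleton_mono:
  assumes ac: "a \<in> {1..n}" "c \<in> {1..n}" and k: "1 \<le> k"
    and r: "0 \<le> r c" "r c \<le> r a" and v: "v c \<le> v a"
  shows "opq_rev_opt M eps v k r {c} \<le> opq_rev_opt M eps v k r {a}"
  unfolding opq_rev_opt_def[of M eps v k r "{c}"]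
proof (rule cSUP_least)
  have val: "opaque_valuation v k {c} e = v c + e c" for e
    using k ac by (simp add: opaque_valuation_def valuation_def)
  let ?P = "\<lambda>b \<rho>. prob {\<omega> \<in> space M. eps 0 \<omega> + \<rho> \<le> opaque_valuation v k {b} (\<lambda>l. eps l \<omega>)}"
  have sell: "\<rho> * ?P c \<rho> \<le> opq_rev_opt M eps v k r {a}" if \<rho>: "0 \<le> \<rho>" "\<rho> \<le> r c" for \<rho>
  proof -
    have "?P c \<rho> \<le> ?P a \<rho>"
      by (rule prob_ge_opaque_mono[where \<sigma> = "\<lambda>_. a"]) (use ac k v in \<open>auto simp: bij_betw_def\<close>)
    then have "\<rho> * ?P c \<rho> \<le> \<rho> * ?P a \<rho>" using \<rho> by (intro mult_left_mono)
    also have "\<dots> \<le> opq_rev M eps v k r {a} \<rho>"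
      by (rule opq_rev_ge) (use ac k \<rho> r in auto)
    also have "\<dots> \<le> opq_rev_opt M eps v k r {a}"
      by (rule opq_rev_le_opt) (use ac k \<rho> r in auto)
    finally show ?thesis .
  qed
  fix \<rho> :: real assume "\<rho> \<in> {0..}"
  then have \<rho>: "0 \<le> \<rho>" by simp
  have c0: "c \<noteq> 0" using ac by simp
  have [measurable]: "eps 0 \<in> borel_measurable M" "eps c \<in> borel_measurable M"
    using ac by (auto intro: eps_measurable)
  show "opq_rev M eps v k r {c} \<rho> \<le> opq_rev_opt M eps v k r {a}"
  proof (cases "\<rho> \<le> r c")
    case True
    \<comment> \<open>A tie goes to the opaque product, so \<open>c\<close> itself is never
      bought.\<close>
    have "choice_prob M eps v k {c} r \<rho> c = prob {}"
      unfolding choice_prob_def using True c0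
      by (intro arg_cong[where f = prob])
        (auto simp: utility_def valuation_def opaque_utility_def val)
    moreover have "opaque_choice_prob M eps v k {c} r \<rho> \<le> ?P c \<rho>"
      by (rule opaque_choice_prob_le[where r = r]) (use ac k True in auto)
    then have "\<rho> * opaque_choice_prob M eps v k {c} r \<rho> \<le> \<rho> * ?P c \<rho>"
      using \<rho> by (intro mult_left_mono)
    ultimately show ?thesis using sell[OF \<rho> True] by (simp add: opq_rev_def)
  next
    case False
    \<comment> \<open>Now only \<open>c\<close> itself sells, and its sales are matched by the
      opaque price \<open>r c\<close>.\<close>
    have "choice_prob M eps v k {c} r \<rho> c \<le> ?P c (r c)"
      unfolding choice_prob_def val using c0
      by (intro finite_measure_mono) (auto simp: utility_def valuation_def)
    then have "r c * choice_prob M eps v k {c} r \<rho> c \<le> r c * ?P c (r c)"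
      using r by (intro mult_left_mono)
    moreover have "opaque_choice_prob M eps v k {c} r \<rho> = 0"
      using False c0 k by (intro opaque_choice_prob_eq_0) auto
    ultimately show ?thesis using sell[of "r c"] r by (simp add: opq_rev_def)
  qed
qed simp

section \<open>NRV candidates and the factor two\<close>

text \<open>Ranking indices start at 1, so the level set has to be nonempty; a product priced at
  least \<open>\<rho>\<close> ensures this.\<close>

lemma nrv_candidatesI:
  assumes "\<rho> \<le> r i" "i \<in> {1..m}" "j \<in> {1..m}"
  shows "{i \<in> {1..m}. \<rho> \<le> r i} \<inter> top_ranked m v j \<in> nrv_candidates m r v"
proof -
  let ?A = "{i \<in> {1..m}. \<rho> \<le> r i}"
  have "card ?A \<le> card {1..m}" by (intro card_mono) auto
  moreover have "i \<in> ?A" using assms by simp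
  then have "0 < card ?A" by (intro card_gt_0_iff[THEN iffD2]) auto
  ultimately have "card ?A \<in> {1..m}" by simp
  then show ?thesis
    unfolding nrv_candidates_def using level_set_eq_top_ranked[of m \<rho> r] assms(3) by blast
qed

lemma nrv_candidates_subset: "C \<in> nrv_candidates m r v \<Longrightarrow> C \<subseteq> {1..m}"
  unfolding nrv_candidates_def using top_ranked_subset by blast

text \<open>The products of \<open>S\<close> priced at least \<open>\<rho>\<close> are replaced by equally many products with the
  highest valuations among all products priced at least \<open>\<rho>\<close>.\<close>

lemma opaque_rev_le_nrv:
  assumes S: "S \<subseteq> {1..n}" "i \<in> S" "\<rho> \<le> r i" and k: "1 \<le> k" and \<rho>: "0 \<le> \<rho>"
  shows "\<exists>C \<in> nrv_candidates n r v.
    \<rho> * opaque_choice_prob M eps v k S r \<rho> \<le> opq_rev_opt M eps v k r C"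
proof -
  define T where "T = {i \<in> S. \<rho> \<le> r i}"
  define X where "X = {i \<in> {1..n}. \<rho> \<le> r i}"
  have X: "finite X" "X \<subseteq> {1..n}" "T \<subseteq> X" "T \<noteq> {}"
    using S by (auto simp: T_def X_def)
  have finT: "finite T" using X finite_subset by blast
  \<comment> \<open>Prefixes of the valuation ranking meet \<open>X\<close> in sets of every size up
    to \<open>card X\<close>; the size of \<open>T\<close> is chosen.\<close>
  obtain j where j: "j \<le> n" "card (X \<inter> top_ranked n v j) = card T"
    using ex_top_ranked_Int_card[of X n "card T" v] X card_mono[of X T] by blast
  define U where "U = X \<inter> top_ranked n v j"
  have U: "U \<subseteq> X" "card T = card U" "U \<noteq> {}"
    using j X finT by (auto simp: U_def)
  have U': "U \<subseteq> {1..n}" "\<And>i. i \<in> U \<Longrightarrow> \<rho> \<le> r i" using U by (auto simp: X_def)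
  have "j \<noteq> 0" using U by (auto simp: U_def top_ranked_0)
  then have cand: "U \<in> nrv_candidates n r v"
    unfolding U_def X_def using S j by (intro nrv_candidatesI) auto
  have "\<exists>\<sigma>. bij_betw \<sigma> T U \<and> (\<forall>i\<in>T. v i \<le> v (\<sigma> i))"
  proof (rule ex_bij_betw_top[OF X(1) X(3) U(1,2)])
    fix a b assume "a \<in> U" "b \<in> X - U"
    then show "v b \<le> v a" using X(2) by (intro le_top_ranked[of a n v j]) (auto simp: U_def)
  qed
  then obtain \<sigma> where \<sigma>: "bij_betw \<sigma> T U" "\<And>i. i \<in> T \<Longrightarrow> v i \<le> v (\<sigma> i)" by blast
  have "opaque_choice_prob M eps v k S r \<rho>
      \<le> prob {\<omega> \<in> space M. eps 0 \<omega> + \<rho> \<le> opaque_valuation v k T (\<lambda>l. eps l \<omega>)}"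
    using S(1) T_def X(4) k by (rule opaque_choice_prob_le)
  also have "\<dots> \<le> prob {\<omega> \<in> space M. eps 0 \<omega> + \<rho> \<le> opaque_valuation v k U (\<lambda>l. eps l \<omega>)}"
    by (rule prob_ge_opaque_mono) (use X U' k \<sigma> in auto)
  finally have "\<rho> * opaque_choice_prob M eps v k S r \<rho>
      \<le> \<rho> * prob {\<omega> \<in> space M. eps 0 \<omega> + \<rho> \<le> opaque_valuation v k U (\<lambda>l. eps l \<omega>)}"
    using \<rho> by (intro mult_left_mono)
  also have "\<dots> \<le> opq_rev M eps v k r U \<rho>"
    using U' U(3) k \<rho> by (intro opq_rev_ge)
  also have "\<dots> \<le> opq_rev_opt M eps v k r U"
    using U' k \<rho> by (intro opq_rev_le_opt) force+
  finally show ?thesis using cand by blast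
qed

lemma opq_rev_opt_le_twice_nrv:
  assumes S: "S \<subseteq> {1..n}" and n: "1 \<le> n" and k: "1 \<le> k"
    and r: "\<And>i. i \<in> {1..n} \<Longrightarrow> 0 \<le> r i"
  shows "opq_rev_opt M eps v k r S
    \<le> 2 * Max (opq_rev_opt M eps v k r ` nrv_candidates n r v)"
proof -
  define R where "R = Max (opq_rev_opt M eps v k r ` nrv_candidates n r v)"
  have "nrv_candidates n r v \<subseteq> Pow {1..n}" using nrv_candidates_subset by blast
  then have "finite (nrv_candidates n r v)" by (rule finite_subset) simp
  then have R: "opq_rev_opt M eps v k r C \<le> R" if "C \<in> nrv_candidates n r v" for C
    unfolding R_def using that by (intro Max_ge) auto
  \<comment> \<open>The full assortment is a candidate, which gives
    \<open>0 \<le> R\<close>.\<close>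
  have "top_ranked n r n \<inter> top_ranked n v n \<in> nrv_candidates n r v"
    unfolding nrv_candidates_def using n by fastforce
  from R[OF this] have R0: "0 \<le> R"
    using opq_rev_opt_nonneg[of "{1..n}" k r v] k r by (simp add: top_ranked_all)
  \<comment> \<open>The best candidate value \<open>R\<close> itself serves as the price threshold.
    The level set is a candidate if it is nonempty; otherwise its revenue is 0.\<close>
  have "mnl_rev v r {i \<in> {1..n}. R \<le> r i} \<le> R"
  proof (cases "{i \<in> {1..n}. R \<le> r i} = {}")
    case True
    then show ?thesis using R0 by (simp only: mnl_rev_def sum.empty)
  next
    case False
    then obtain i where "i \<in> {1..n}" "R \<le> r i" by blast
    then have "{i \<in> {1..n}. R \<le> r i} \<inter> top_ranked n v n \<in> nrv_candidates n r v"
      using n by (intro nrv_candidatesI) auto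
    moreover have "{i \<in> {1..n}. R \<le> r i} \<inter> top_ranked n v n = {i \<in> {1..n}. R \<le> r i}"
      unfolding top_ranked_all by blast
    ultimately have C: "{i \<in> {1..n}. R \<le> r i} \<in> nrv_candidates n r v" by simp
    have "mnl_rev v r {i \<in> {1..n}. R \<le> r i} \<le> opq_rev_opt M eps v k r {i \<in> {1..n}. R \<le> r i}"
      using k r by (intro mnl_rev_le_opt) auto
    also have "\<dots> \<le> R" using C by (rule R)
    finally show ?thesis .
  qed
  then have mnl: "mnl_rev v r S \<le> R"
    using mnl_rev_le_if_level_set[OF finite_atLeastAtMost S] by blast
  have "opq_rev M eps v k r S \<rho> \<le> 2 * R" if \<rho>: "0 \<le> \<rho>" for \<rho>
  proof (cases "S = {}")
    case True
    then show ?thesis using R0 by (simp add: opq_rev_def)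
  next
    case False
    have fin: "finite S" and S0: "0 \<notin> S" using S finite_subset by auto
    have "(\<Sum>i\<in>S. r i * choice_prob M eps v k S r \<rho> i) \<le> mnl_rev v r S"
      unfolding mnl_rev_def sum_divide_distrib times_divide_eq_right[symmetric]
      using S r by (intro sum_mono mult_left_mono choice_prob_le) auto
    moreover have "\<rho> * opaque_choice_prob M eps v k S r \<rho> \<le> R"
    proof (cases "\<forall>i\<in>S. r i < \<rho>")
      case True
      then show ?thesis using opaque_choice_prob_eq_0[OF fin False k _ S0] R0 by simp
    next
      case notless: False
      then obtain i where "i \<in> S" "\<rho> \<le> r i" by (auto simp: not_less)
      then show ?thesis using opaque_rev_le_nrv[OF S _ _ k \<rho>] R by (meson order_trans)
    qed
    ultimately show ?thesis using False mnl by (simp add: opq_rev_def)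
  qed
  then show ?thesis
    unfolding opq_rev_opt_def[of M eps v k r S] R_def[symmetric] by (intro cSUP_least) auto
qed

end

section \<open>The cases \<open>n = 2\<close> and \<open>n \<ge> 3\<close>\<close>

theorem theorem4:
  fixes M :: "'a measure"
    and eps :: "nat \<Rightarrow> 'a \<Rightarrow> real"
    and n k :: nat
    and r v :: "nat \<Rightarrow> real"
  assumes "prob_space M"
    and "prob_space.indep_vars M (\<lambda>_. borel) eps {0..n}"
    and "\<And>i. i \<in> {0..n} \<Longrightarrow>
           distributed M lborel (eps i) (\<lambda>x. ennreal (std_gumbel_density x))"
    and "k \<in> {1..n}"
    and "\<And>i. i \<in> {1..n} \<Longrightarrow> 0 \<le> r i"
  shows "(n = 2 \<longrightarrow>
            (\<exists>S. is_arg_max (opq_rev_opt M eps v k r) (\<lambda>S. S \<subseteq> {1..n}) S \<and>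
                 is_arg_max (opq_rev_opt M eps v k r) (\<lambda>S. S \<in> nrv_candidates n r v) S)) \<and>
         (n \<ge> 3 \<longrightarrow>
            (\<forall>S. is_arg_max (opq_rev_opt M eps v k r) (\<lambda>S. S \<subseteq> {1..n}) S \<longrightarrow>
                 Max (opq_rev_opt M eps v k r ` nrv_candidates n r v)
                   \<ge> 1 / 2 * opq_rev_opt M eps v k r S))"
proof -
  interpret prob_space M by fact
  interpret gumbel_noise M eps n by unfold_locales fact+
  let ?F = "opq_rev_opt M eps v k r" and ?N = "nrv_candidates n r v"
  have k: "1 \<le> k" and n: "1 \<le> n" using assms(4) by auto
  have "\<exists>S. is_arg_max ?F (\<lambda>S. S \<subseteq> {1..n}) S \<and> is_arg_max ?F (\<lambda>S. S \<in> ?N) S" if n2: "n = 2"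
  proof -
    have N12: "{1..n} = {1, 2}" using n2 by auto
    \<comment> \<open>With two products a ranking is determined by its first product
      \<open>a\<close>, and \<open>b\<close> is the other one.\<close>
    have top1: "\<exists>a b. {1..n} = {a, b} \<and> a \<noteq> b \<and> top_ranked n f 1 = {a} \<and> f b \<le> f a" for f
    proof -
      obtain a where a: "top_ranked n f 1 = {a}"
        using card_top_ranked[of 1 n f] n by (auto simp: card_1_singleton_iff)
      have "a \<in> {1, 2}" using top_ranked_subset[of n f 1] unfolding a N12 by simp
      then have "{1..n} = {a, 3 - a}" "a \<noteq> 3 - a" unfolding N12 by auto
      then obtain b where b: "{1..n} = {a, b}" "a \<noteq> b" by blast
      have "f b \<le> f a" using b by (intro le_top_ranked[of a n f 1]) (simp_all only: a, auto)
      then show ?thesis using a b by blast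
    qed
    obtain a b where ab: "{1..n} = {a, b}" "a \<noteq> b" "top_ranked n r 1 = {a}" "r b \<le> r a"
      using top1 by blast
    obtain c d where cd: "{1..n} = {c, d}" "c \<noteq> d" "top_ranked n v 1 = {c}" "v d \<le> v c"
      using top1 by blast
    have cand: "top_ranked n r i \<inter> top_ranked n v j \<in> ?N" if "i \<in> {1, 2}" "j \<in> {1, 2}" for i j
      unfolding nrv_candidates_def N12 using that by blast
    have rn: "top_ranked n f 2 = {1..n}" for f using top_ranked_all[of n f] n2 by simp
    \<comment> \<open>These arise from the index pairs (2,2), (1,2), (2,1) and (1,1).\<close>
    have all: "{a, b} \<in> ?N" "{a} \<in> ?N" "{c} \<in> ?N" "{a} \<inter> {c} \<in> ?N"
      using cand[of 2 2] cand[of 1 2] cand[of 2 1] cand[of 1 1] ab cd by (auto simp: rn)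
    obtain S where S: "S \<subseteq> {1..n}" "\<And>T. T \<subseteq> {1..n} \<Longrightarrow> ?F T \<le> ?F S"
    proof -
      have "Max (?F ` Pow {1..n}) \<in> ?F ` Pow {1..n}" by (rule Max_in) auto
      then obtain S where "S \<subseteq> {1..n}" "Max (?F ` Pow {1..n}) = ?F S" by auto
      moreover have "?F T \<le> Max (?F ` Pow {1..n})" if "T \<subseteq> {1..n}" for T
        using that by (intro Max_ge) auto
      ultimately show thesis using that by simp
    qed
    have "\<exists>S'\<in>?N. ?F S \<le> ?F S'"
    proof (cases "S \<in> ?N")
      case False
      have "S \<subseteq> {a, b}" using S(1) ab(1) by simp
      then have "S = {} \<or> S = {a} \<or> S = {b} \<or> S = {a, b}" by blast
      then have S': "S = {} \<or> S = {b}" using False all by auto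
      have "c \<in> {a, b}" using ab(1) cd(1) by auto
      \<comment> \<open>If \<open>c = b\<close>, then \<open>{c} = {b}\<close> and
        \<open>{a} \<inter> {c} = {}\<close> would be candidates, and so would \<open>S\<close>.
        Hence \<open>a\<close> leads both rankings and dominates \<open>b\<close>.\<close>
      then have "c = a" using S' False all ab(2) by auto
      then have "d = b" using ab cd by auto
      have "?F {b} \<le> ?F {a}"
        using ab cd \<open>c = a\<close> \<open>d = b\<close> k assms(5) by (intro opq_rev_opt_singleton_mono) auto
      moreover have "0 \<le> ?F {a}"
        using ab k assms(5) by (intro opq_rev_opt_nonneg) auto
      ultimately show ?thesis using S' all(2) by (auto simp: opq_rev_opt_empty)
    qed blast
    then obtain S' where S': "S' \<in> ?N" "?F S \<le> ?F S'" by blast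
    have "?F T \<le> ?F S'" if "T \<subseteq> {1..n}" for T
      using S(2)[OF that] S'(2) by simp
    then have max: "\<not> ?F S' < ?F T" if "T \<subseteq> {1..n}" for T
      using that by (simp add: not_less)
    have "is_arg_max ?F (\<lambda>S. S \<subseteq> {1..n}) S'" "is_arg_max ?F (\<lambda>S. S \<in> ?N) S'"
      unfolding is_arg_max_def using S'(1) max nrv_candidates_subset by blast+
    then show ?thesis by blast
  qed
  moreover have "Max (?F ` ?N) \<ge> 1 / 2 * ?F S" if "is_arg_max ?F (\<lambda>S. S \<subseteq> {1..n}) S" for S
    using opq_rev_opt_le_twice_nrv[of S k r v] that n k assms(5) by (simp add: is_arg_max_def)
  ultimately show ?thesis by blast
qed

end
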